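(* Let $r \ge 2$ be an integer and let $\varepsilon > 0$. Then there exist constants $n_0, b_0, c_0 > 0$ depending only on $r$ and $\varepsilon$ such that the following holds. Let $n \in \mathbb{N}$ and $m > 0$ satisfy $n \geq n_0$ and $(\frac{r-1}{r} + \varepsilon)n \le m \le b_0n^{\frac{r+1}{r}}$. Then there exists an $(r+1)$-saturated graph $G$ on $n$ vertices with $e(G) \geq t_r(n) - m$ that has no (induced) complete $r$-partite subgraph on more than $\left(1 - c_0mn^{-\frac{r+1}{r}}\right)n$ vertices.
   Context: All graphs are finite and simple. A graph is $(r+1)$-saturated if it contains no $K_{r+1}$ but adding any edge of its complement creates a $K_{r+1}$. $t_r(n)$ is the number of edges of the $r$-partite Turán graph on $n$ vertices (complete $r$-partite with class sizes $\lfloor n/r\rfloor$ or $\lceil n/r\rceil$). A complete $r$-partite subgraph on vertex set $U$ means that the induced subgraph $G[U]$ is complete $r$-partite. *)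

theory Defs
  imports Complex_Main "HOL-Library.Ramsey"
begin

definition simple_graph :: "'a set \<Rightarrow> 'a set set \<Rightarrow> bool" where
  "simple_graph V E \<longleftrightarrow> finite V \<and> E \<subseteq> [V]\<^bsup>2\<^esup>"

definition contains_complete :: "nat \<Rightarrow> 'a set \<Rightarrow> 'a set set \<Rightarrow> bool" where
  "contains_complete k V E \<longleftrightarrow> (\<exists>R \<in> [V]\<^bsup>k\<^esup>. clique R E)"

definition saturated :: "nat \<Rightarrow> 'a set \<Rightarrow> 'a set set \<Rightarrow> bool" where
  "saturated k V E \<longleftrightarrow>
     \<not> contains_complete k V E \<and> (\<forall>e \<in> [V]\<^bsup>2\<^esup> - E. contains_complete k V (insert e E))"

definition induced_edges :: "'a set set \<Rightarrow> 'a set \<Rightarrow> 'a set set" where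
  "induced_edges E U = {e \<in> E. e \<subseteq> U}"

definition partite_edges :: "'a set \<Rightarrow> ('a \<Rightarrow> nat) \<Rightarrow> 'a set set" where
  "partite_edges V p = {{x, y} | x y. x \<in> V \<and> y \<in> V \<and> p x \<noteq> p y}"

text \<open>The classes are \<open>{v \<in> V. p v = i}\<close> for \<open>i < r\<close>. They may be empty, so a complete
  \<open>s\<close>-partite graph with \<open>s \<le> r\<close> is also complete \<open>r\<close>-partite. This is the convention under
  which the Turan graph is complete \<open>r\<close>-partite even when it has fewer than \<open>r\<close> vertices.\<close>

definition complete_partite :: "nat \<Rightarrow> 'a set \<Rightarrow> 'a set set \<Rightarrow> bool" where
  "complete_partite r V E \<longleftrightarrow> (\<exists>p. (\<forall>v\<in>V. p v < r) \<and> E = partite_edges V p)"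

text \<open>The \<open>r\<close>-partite Turan graph on \<open>{..<n}\<close>, with the residue classes modulo \<open>r\<close> as its classes;
  \<open>turan_class_size\<close> below shows that they have the required sizes.\<close>

definition turan_edges :: "nat \<Rightarrow> nat \<Rightarrow> nat set set" where
  "turan_edges r n = partite_edges {..<n} (\<lambda>v. v mod r)"

definition turan_number :: "nat \<Rightarrow> nat \<Rightarrow> nat" where
  "turan_number r n = card (turan_edges r n)"

lemma complete_partite_turan:
  "r > 0 \<Longrightarrow> complete_partite r {..<n} (turan_edges r n)"
  unfolding complete_partite_def turan_edges_def by (intro exI[of _ "\<lambda>v. v mod r"]) auto

lemma turan_class_size:
  fixes r n i :: nat
  assumes "i < r"
  shows "int (card {v \<in> {..<n}. v mod r = i}) \<in> {\<lfloor>real n / real r\<rfloor>, \<lceil>real n / real r\<rceil>}"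
proof -
  have r: "r > 0" using assms by simp
  define q where "q = n div r + (if i < n mod r then 1 else 0)"
  have iff: "r * k + i < n \<longleftrightarrow> k < q" for k
  proof -
    have n: "n = r * (n div r) + n mod r" by simp
    have m: "n mod r < r" using r by simp
    consider "k < n div r" | "k = n div r" | "k > n div r" by linarith
    then show ?thesis
    proof cases
      case 1
      then have "r * Suc k \<le> r * (n div r)" by (intro mult_le_mono2) simp
      then have "r + r * k \<le> r * (n div r)" by simp
      then have "r * k + i < n" using n assms by linarith
      then show ?thesis using 1 by (simp add: q_def)
    next
      case 2
      have "r * k + i < n \<longleftrightarrow> i < n mod r" using n unfolding 2 by linarith
      then show ?thesis using 2 by (simp add: q_def)
    next
      case 3
      then have "r * Suc (n div r) \<le> r * k" by (intro mult_le_mono2) simp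
      then have "r + r * (n div r) \<le> r * k" by simp
      then have "\<not> r * k + i < n" using n m by linarith
      then show ?thesis using 3 by (simp add: q_def)
    qed
  qed
  have "{v \<in> {..<n}. v mod r = i} = (\<lambda>k. r * k + i) ` {..<q}"
  proof (intro equalityI subsetI)
    fix v assume v: "v \<in> {v \<in> {..<n}. v mod r = i}"
    then have eq: "r * (v div r) + i = v" by (metis (mono_tags, lifting) mem_Collect_eq mult_div_mod_eq)
    then have "v div r < q" using v iff[of "v div r"] by simp
    then show "v \<in> (\<lambda>k. r * k + i) ` {..<q}" using eq by (metis imageI lessThan_iff)
  next
    fix v assume "v \<in> (\<lambda>k. r * k + i) ` {..<q}"
    then obtain k where "k < q" and v: "v = r * k + i" by blast
    then have "v < n" using iff by blast
    moreover have "v mod r = i" unfolding v using assms by simp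
    ultimately show "v \<in> {v \<in> {..<n}. v mod r = i}" by blast
  qed
  moreover have "inj_on (\<lambda>k. r * k + i) {..<q}" using r by (simp add: inj_on_def)
  ultimately have card: "card {v \<in> {..<n}. v mod r = i} = q" by (simp add: card_image)
  have fl: "\<lfloor>real n / real r\<rfloor> = int (n div r)" by (simp add: floor_divide_of_nat_eq)
  show ?thesis
  proof (cases "i < n mod r")
    case True
    define d where "d = n div r"
    have n: "n = r * d + n mod r" by (simp add: d_def)
    have m: "n mod r < r" using r by simp
    have "d * r < n" using n True by (metis add_less_same_cancel1 less_add_same_cancel1 mult.commute gr_zeroI not_less_zero)
    then have lower: "real d < real n / real r"
      using r by (simp add: pos_less_divide_eq flip: of_nat_mult)
    have "n \<le> r * d + r" using n m by linarith
    also have "\<dots> = (d + 1) * r" by (simp add: algebra_simps)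
    finally have upper: "real n / real r \<le> real (d + 1)"
      using r by (simp only: pos_divide_le_eq of_nat_0_less_iff of_nat_mult[symmetric] of_nat_le_iff)
    have "\<lceil>real n / real r\<rceil> = int d + 1"
      by (rule ceiling_unique) (use lower upper in simp_all)
    then have "\<lceil>real n / real r\<rceil> = int (n div r) + 1" by (simp add: d_def)
    then show ?thesis using True card by (simp add: q_def)
  next
    case False
    then show ?thesis using fl card by (simp add: q_def)
  qed
qed

end

theory Submission
  imports Defs
begin

text \<open>
  Start from the balanced complete \<open>r\<close>-partite graph on \<open>N = n - t\<close> vertices and add \<open>t\<close> extra
  vertices forming a level \<open>r\<close>. The vertices with small index in the parts \<open>0, \<dots>, r - 1\<close> are
  arranged into \<open>t\<close> complete \<open>k\<close>-ary trees rooted at the extra vertices: level \<open>l\<close> has height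
  \<open>l - 1\<close>, and levels \<open>0\<close> and \<open>1\<close> both consist of leaves. For \<open>l < l' < r\<close>, a vertex of level \<open>l\<close> is
  disconnected from the vertices of level \<open>l'\<close> with which it has a common ancestor on level
  \<open>l' + 1\<close>, except from its own ancestor. Only about \<open>t k\<^sup>r\<close> edges are lost, and a clique meeting
  all \<open>r + 1\<close> levels would have to be a branch ending in two adjacent leaves of levels \<open>0\<close> and \<open>1\<close>
  with the same parent, so there is none.

  In every \<open>K\<^bsub>r+1\<^esub>\<close>-free supergraph the branches force leaves of levels \<open>0\<close> and \<open>1\<close> with the
  same parent to stay nonadjacent, so a complete \<open>r\<close>-partite induced subgraph misses, below each
  parent, all leaves of level \<open>0\<close> or all leaves of level \<open>1\<close>: at least \<open>t k\<^bsup>r-1\<^esup>\<close> vertices. Choose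
  \<open>t\<close> of order \<open>m / n\<close> and \<open>k\<close> of order \<open>n\<^bsup>1/r\<^esup>\<close>, and saturate.
\<close>

section \<open>Edges, cliques and saturation\<close>

lemma pair_in_partite_edges: "{u, w} \<in> partite_edges V p \<longleftrightarrow> u \<in> V \<and> w \<in> V \<and> p u \<noteq> p w"
  unfolding partite_edges_def by (auto simp: doubleton_eq_iff)

lemma finite_partite_edges:
  assumes "finite V"
  shows "finite (partite_edges V p)"
proof (rule finite_subset)
  show "partite_edges V p \<subseteq> Pow V" by (auto simp: partite_edges_def)
qed (use assms in simp)

lemma pair_in_nsets2: "{u, w} \<in> [V]\<^bsup>2\<^esup> \<longleftrightarrow> u \<in> V \<and> w \<in> V \<and> u \<noteq> w"
  by (auto simp: nsets_def card_insert_if)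

lemma contains_complete_family:
  assumes E: "E \<subseteq> [V]\<^bsup>2\<^esup>" and k: "2 \<le> k"
    and adj: "\<And>i j. i < j \<Longrightarrow> j < k \<Longrightarrow> {h i, h j} \<in> E"
  shows "contains_complete k V E"
proof -
  have dist: "h i \<in> V \<and> h j \<in> V \<and> h i \<noteq> h j" if "i < j" "j < k" for i j
    using subsetD[OF E adj[OF that]] by (simp only: pair_in_nsets2 simp_thms)
  have inj: "inj_on h {..<k}"
    by (rule linorder_inj_onI) (use dist in auto)
  have V: "h i \<in> V" if "i < k" for i
    using dist[of 0 i] dist[of 0 1] that k by (cases "i = 0") auto
  have "h ` {..<k} \<in> [V]\<^bsup>k\<^esup>"
    using V by (auto simp: nsets_def card_image[OF inj])
  moreover have "clique (h ` {..<k}) E"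
    unfolding clique_def
  proof (intro ballI impI)
    fix u w assume "u \<in> h ` {..<k}" "w \<in> h ` {..<k}" "u \<noteq> w"
    then obtain i j where ij: "i < k" "j < k" "u = h i" "w = h j" "i \<noteq> j" by blast
    then consider "i < j" | "j < i" by linarith
    then show "{u, w} \<in> E"
      by cases (use adj[of i j] adj[of j i] ij in \<open>auto simp: insert_commute\<close>)
  qed
  ultimately show ?thesis unfolding contains_complete_def by blast
qed

text \<open>Only finitely many edge sets above \<open>E0\<close> avoid a complete graph on
  \<open>k\<close> vertices, and an inclusion-maximal one among them is saturated.\<close>

lemma saturated_extension:
  assumes "finite V" "E0 \<subseteq> [V]\<^bsup>2\<^esup>" "\<not> contains_complete k V E0"
  obtains E where "E0 \<subseteq> E" "E \<subseteq> [V]\<^bsup>2\<^esup>" "saturated k V E"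
proof -
  define F where "F = {E. E0 \<subseteq> E \<and> E \<subseteq> [V]\<^bsup>2\<^esup> \<and> \<not> contains_complete k V E}"
  have "finite F"
  proof (rule finite_subset)
    show "F \<subseteq> Pow ([V]\<^bsup>2\<^esup>)" by (auto simp: F_def)
    show "finite (Pow ([V]\<^bsup>2\<^esup>))" using assms(1) by (simp add: finite_imp_finite_nsets)
  qed
  moreover have "E0 \<in> F" using assms by (auto simp: F_def)
  ultimately obtain E where E: "E \<in> F" and max: "\<And>E'. E' \<in> F \<Longrightarrow> E \<subseteq> E' \<Longrightarrow> E' = E"
    using finite_has_maximal[of F] by blast
  have "contains_complete k V (insert e E)" if e: "e \<in> [V]\<^bsup>2\<^esup> - E" for e
  proof (rule ccontr)
    assume "\<not> ?thesis"
    then have "insert e E \<in> F" using E e by (auto simp: F_def)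
    then show False using max[of "insert e E"] e by blast
  qed
  then have "saturated k V E" using E by (auto simp: saturated_def F_def)
  then show thesis using that E by (auto simp: F_def)
qed

section \<open>Growth of the Turan number\<close>

text \<open>The new vertex \<open>n\<close> has its neighbours in \<open>S\<close>. Its own residue
  class contains the \<open>n div r\<close> vertices of \<open>C\<close> below \<open>n\<close>, so
  \<open>card S\<close> is at most \<open>n - n div r\<close>, and \<open>n div r + 1\<close> is at
  least \<open>(n + 1) / r\<close>.\<close>

lemma turan_number_Suc:
  assumes "0 < r"
  shows "real (turan_number r (Suc n)) \<le> real (turan_number r n) + (real r - 1) / real r * real (Suc n)"
proof -
  define S where "S = {v. v < n \<and> v mod r \<noteq> n mod r}"
  have "turan_edges r (Suc n) \<subseteq> turan_edges r n \<union> (\<lambda>v. {v, n}) ` S"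
  proof
    fix e assume "e \<in> turan_edges r (Suc n)"
    then obtain u w where e: "e = {u, w}" "u < Suc n" "w < Suc n" "u mod r \<noteq> w mod r"
      by (auto simp: turan_edges_def partite_edges_def)
    then consider "u < n" "w < n" | "u = n" "w < n" | "w = n" "u < n"
      by (metis less_SucE)
    then show "e \<in> turan_edges r n \<union> (\<lambda>v. {v, n}) ` S"
    proof cases
      case 1
      then show ?thesis
        using e by (simp add: turan_edges_def pair_in_partite_edges)
    next
      case 2
      then have "w \<in> S" "e = {w, n}" using e by (auto simp: S_def)
      then show ?thesis by blast
    next
      case 3
      then have "u \<in> S" "e = {u, n}" using e by (auto simp: S_def)
      then show ?thesis by blast
    qed
  qed
  moreover have fin: "finite (turan_edges r n)" "finite S"
    by (simp_all add: turan_edges_def finite_partite_edges S_def)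
  ultimately have "turan_number r (Suc n) \<le> card (turan_edges r n \<union> (\<lambda>v. {v, n}) ` S)"
    unfolding turan_number_def by (intro card_mono) auto
  also have "\<dots> \<le> turan_number r n + card ((\<lambda>v. {v, n}) ` S)"
    unfolding turan_number_def by (rule card_Un_le)
  also have "\<dots> \<le> turan_number r n + card S"
    using card_image_le[OF fin(2)] by simp
  finally have le: "turan_number r (Suc n) \<le> turan_number r n + card S" .
  define C where "C = (\<lambda>j. j * r + n mod r) ` {..<n div r}"
  have inj: "inj_on (\<lambda>j. j * r + n mod r) {..<n div r}"
    using assms by (auto simp: inj_on_def)
  have "j * r + n mod r < n" if "j < n div r" for j
  proof -
    have "j * r < n div r * r" using that assms by simp
    then show ?thesis using div_mult_mod_eq[of n r] by linarith
  qed
  then have C: "C \<subseteq> {..<n}" "C \<inter> S = {}" by (auto simp: C_def S_def)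
  have "card C + card S = card (C \<union> S)"
    using C(2) fin(2) by (simp add: C_def card_Un_disjoint)
  also have "\<dots> \<le> card {..<n}" using C(1) by (intro card_mono) (auto simp: S_def)
  finally have "n div r + card S \<le> n" by (simp add: C_def card_image[OF inj])
  moreover have "real (Suc n) \<le> real r * (real (n div r) + 1)"
  proof -
    have "n < r * Suc (n div r)" using assms dividend_less_times_div[of r n] by simp
    then have "real (Suc n) \<le> real (r * Suc (n div r))" by (intro of_nat_mono) simp
    then show ?thesis by (simp add: algebra_simps)
  qed
  moreover have "(real r - 1) / real r * real (Suc n) = real (Suc n) - real (Suc n) / real r"
    using assms by (simp add: field_simps)
  moreover have "real (Suc n) / real r \<le> real (n div r) + 1"
    using calculation(2) assms by (simp add: pos_divide_le_eq mult.commute)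
  ultimately have "real (card S) \<le> (real r - 1) / real r * real (Suc n)" by linarith
  then show ?thesis using le by linarith
qed

text \<open>This bounds the edges given up by starting from only \<open>N = n - t\<close>
  vertices.\<close>

lemma turan_number_add:
  assumes "0 < r"
  shows "real (turan_number r (n + t)) \<le>
    real (turan_number r n) + real t * ((real r - 1) / real r * real (n + t))"
proof (induction t)
  case (Suc t)
  let ?a = "(real r - 1) / real r"
  have "0 \<le> ?a" using assms by simp
  then have "real t * (?a * real (n + t)) \<le> real t * (?a * real (n + Suc t))"
    by (intro mult_left_mono) auto
  moreover have "real (turan_number r (n + Suc t)) \<le>
      real (turan_number r (n + t)) + ?a * real (n + Suc t)"
    using turan_number_Suc[OF assms, of "n + t"] by simp
  moreover have "real (Suc t) * (?a * real (n + Suc t)) =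
      real t * (?a * real (n + Suc t)) + ?a * real (n + Suc t)"
    by (simp only: of_nat_Suc distrib_right mult_1_left add.commute)
  ultimately show ?case using Suc by linarith
qed simp

section \<open>The layered graph\<close>

text \<open>By \<open>room\<close>, each level below \<open>r\<close> has at least
  \<open>2 * M\<close> indices, where \<open>M = t * k ^ (r - 1)\<close> is the number of leaves on
  level 0 and on level 1. Tree vertices have index below \<open>M\<close>, so \<open>M\<close>
  further indices per level stay outside the trees.\<close>

locale layered =
  fixes r k t N :: nat
  assumes r2: "2 \<le> r" and k0: "0 < k" and t0: "0 < t"
    and room: "2 * r * (t * k ^ (r - 1)) \<le> N"
begin

abbreviation "M \<equiv> t * k ^ (r - 1)"

text \<open>The vertex \<open>v < N\<close> has level \<open>v mod r\<close> and index \<open>v div r\<close> in that level. Its ancestor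
  at height \<open>j\<close> is only meaningful for \<open>j\<close> at least the height \<open>v mod r - 1\<close> of \<open>v\<close>, where the
  truncated subtraction gives levels \<open>0\<close> and \<open>1\<close> the same height.\<close>

definition anc :: "nat \<Rightarrow> nat \<Rightarrow> nat" where
  "anc j v = v div r div k ^ (j - (v mod r - 1))"

text \<open>These are the removed pairs, for \<open>v\<close> on a lower level than
  \<open>w\<close>. The first conjunct puts \<open>v\<close> into a tree; the second gives a common
  ancestor one level above \<open>w\<close>. As \<open>anc (w mod r - 1) w\<close> is the index of
  \<open>w\<close> itself, the last inequality says that \<open>w\<close> is not an ancestor of
  \<open>v\<close>. It is waived on level 1, where \<open>w\<close> is a leaf and never an ancestor,
  even if the indices agree.\<close>

definition bad :: "nat \<Rightarrow> nat \<Rightarrow> bool" where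
  "bad v w \<longleftrightarrow> anc (r - 1) v < t \<and> anc (w mod r) v = anc (w mod r) w \<and>
     (w mod r = 1 \<or> anc (w mod r - 1) v \<noteq> anc (w mod r - 1) w)"

definition part_edges :: "nat set set" where
  "part_edges = {{v, w} | v w. v < N \<and> w < N \<and> v mod r < w mod r \<and> \<not> bad v w}"

text \<open>Root \<open>i < t\<close> is the vertex \<open>N + i\<close>. It is joined to the
  vertices of its own tree and to nothing else.\<close>

definition root_edges :: "nat set set" where
  "root_edges = {{v, N + anc (r - 1) v} | v. v < N \<and> anc (r - 1) v < t}"

definition base_edges :: "nat set set" where
  "base_edges = part_edges \<union> root_edges"

definition level :: "nat \<Rightarrow> nat" where
  "level v = (if v < N then v mod r else r)"

lemma mod_less: "v mod r < r"
  using r2 by simp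

lemma level1_vertex: "Suc (b * r) div r = b" "Suc (b * r) mod r = 1"
  using r2 div_mult_self3[of r b 1] mod_mult_self3[of b r 1] by simp_all

lemma M0: "0 < M"
  using t0 k0 by simp

lemma anc_div:
  assumes "v mod r - 1 \<le> j"
  shows "anc (j + i) v = anc j v div k ^ i"
proof -
  have "j + i - (v mod r - 1) = (j - (v mod r - 1)) + i" using assms by simp
  then show ?thesis by (simp only: anc_def power_add div_mult2_eq)
qed

lemma anc_eq_mono:
  assumes "anc j v = anc j w" "v mod r - 1 \<le> j" "w mod r - 1 \<le> j" "j \<le> j'"
  shows "anc j' v = anc j' w"
  using anc_div[of v j "j' - j"] anc_div[of w j "j' - j"] assms by simp

lemma anc_top_less:
  assumes "anc (r - 1) v < t"
  shows "v div r < M"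
proof -
  let ?e = "r - 1 - (v mod r - 1)"
  have "v div r < t * k ^ ?e"
    using assms k0 by (simp add: anc_def less_mult_imp_div_less div_less_iff_less_mult)
  also have "\<dots> \<le> M" using k0 by (intro mult_left_mono power_increasing) auto
  finally show ?thesis .
qed

text \<open>A common ancestor at height \<open>w mod r\<close> remains common up to the root, so
  \<open>w\<close> lies in the same tree as \<open>v\<close>.\<close>

lemma bad_index_less:
  assumes "bad v w" "v mod r < w mod r"
  shows "v div r < M" "w div r < M"
proof -
  have top: "anc (r - 1) v < t" using assms by (simp add: bad_def)
  then show "v div r < M" by (rule anc_top_less)
  have "anc (r - 1) v = anc (r - 1) w"
  proof (rule anc_eq_mono)
    show "anc (w mod r) v = anc (w mod r) w" using assms by (simp add: bad_def)
    show "w mod r \<le> r - 1" using mod_less[of w] by simp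
  qed (use assms in simp_all)
  then show "w div r < M" using top by (intro anc_top_less) simp
qed

lemma base_edge_levels:
  assumes "{u, w} \<in> base_edges"
  shows "u < N + t" "w < N + t" "level u \<noteq> level w" "level u \<le> r" "level w \<le> r"
proof -
  obtain v v' where vv: "{u, w} = {v, v'}" and v: "v < N" "v' < N + t" "level v < level v'" "level v' \<le> r"
  proof (cases "{u, w} \<in> part_edges")
    case True
    then obtain v v' where "{u, w} = {v, v'}" "v < N" "v' < N" "v mod r < v' mod r"
      unfolding part_edges_def by blast
    then show thesis using that[of v v'] mod_less[of v'] by (simp add: level_def)
  next
    case False
    then have "{u, w} \<in> root_edges" using assms by (simp add: base_edges_def)
    then obtain v where "{u, w} = {v, N + anc (r - 1) v}" "v < N" "anc (r - 1) v < t"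
      unfolding root_edges_def by blast
    then show thesis using that[of v "N + anc (r - 1) v"] mod_less[of v] by (simp add: level_def)
  qed
  have "u = v \<and> w = v' \<or> u = v' \<and> w = v" using vv by (simp add: doubleton_eq_iff)
  then show "u < N + t" "w < N + t" "level u \<noteq> level w" "level u \<le> r" "level w \<le> r"
    using v by auto
qed

lemma base_edges_subset: "base_edges \<subseteq> [{..<N + t}]\<^bsup>2\<^esup>"
proof
  fix e assume e: "e \<in> base_edges"
  then obtain u w where "e = {u, w}" by (auto simp: base_edges_def part_edges_def root_edges_def)
  then show "e \<in> [{..<N + t}]\<^bsup>2\<^esup>" using base_edge_levels[of u w] e by (auto simp: pair_in_nsets2)
qed

lemma base_edge_below:
  assumes "{v, w} \<in> base_edges" "v < N" "w < N" "v mod r < w mod r"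
  shows "\<not> bad v w"
  using assms by (auto simp: base_edges_def part_edges_def root_edges_def doubleton_eq_iff)

lemma base_edge_root:
  assumes "{v, w} \<in> base_edges" "v < N" "\<not> w < N"
  shows "anc (r - 1) v = w - N \<and> anc (r - 1) v < t"
  using assms by (auto simp: base_edges_def part_edges_def root_edges_def doubleton_eq_iff)

section \<open>Absence of large cliques\<close>

text \<open>Such a clique has one vertex \<open>f l\<close> on each level. The edges at
  \<open>f r\<close> put all of them into one tree, and the pairs that are not bad force them onto
  one branch down to height 1. Then \<open>f 0\<close> and \<open>f 1\<close> have the same parent,
  which is a bad pair.\<close>

lemma base_no_complete: "\<not> contains_complete (r + 1) {..<N + t} base_edges"
proof
  assume "contains_complete (r + 1) {..<N + t} base_edges"
  then obtain R where card: "card R = r + 1" and cl: "clique R base_edges"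
    by (auto simp: contains_complete_def nsets_def)
  have adj: "{u, w} \<in> base_edges" if "u \<in> R" "w \<in> R" "u \<noteq> w" for u w
    using cl that by (auto simp: clique_def)
  have inj: "inj_on level R"
    using adj base_edge_levels(3) by (meson inj_onI)
  have "level ` R \<subseteq> {..r}" using mod_less by (auto simp: level_def less_imp_le)
  moreover have "card (level ` R) = card {..r}" using card card_image[OF inj] by simp
  ultimately have "level ` R = {..r}" by (intro card_subset_eq) auto
  then have "\<forall>l\<in>{..r}. \<exists>v\<in>R. level v = l" by (metis imageE)
  then obtain f where f: "\<And>l. l \<le> r \<Longrightarrow> f l \<in> R \<and> level (f l) = l"
    by (metis atMost_iff)
  have fN: "f l < N \<and> f l mod r = l" if "l < r" for l
    using f[of l] that by (auto simp: level_def split: if_splits)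
  have fr: "\<not> f r < N" using f[of r] mod_less[of "f r"] by (auto simp: level_def)
  have edge: "{f l, f l'} \<in> base_edges" if "l < l'" "l' \<le> r" for l l'
    using that f[of l] f[of l'] by (intro adj) auto
  have root: "anc (r - 1) (f l) = f r - N \<and> anc (r - 1) (f l) < t" if "l < r" for l
    using that fN fr by (intro base_edge_root edge) auto
  have not_bad: "\<not> bad (f l) (f l')" if "l < l'" "l' < r" for l l'
    using that fN edge[of l l'] by (intro base_edge_below) auto
  \<comment> \<open>Descending induction on the height \<open>j = r - 1 - i\<close>. The levels up
    to \<open>j + 1\<close> are those of height at most \<open>j\<close>, where \<open>anc j\<close>
    is meaningful. It stops at height 1, since the exception for level 1 blocks a further
    step.\<close>
  have branch: "\<forall>l\<le>r - 1 - i + 1. \<forall>l'\<le>r - 1 - i + 1. l < r \<longrightarrow> l' < r \<longrightarrow>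
      anc (r - 1 - i) (f l) = anc (r - 1 - i) (f l')" if "i \<le> r - 2" for i
    using that
  proof (induction i)
    case 0
    then show ?case using root by auto
  next
    case (Suc i)
    define j where "j = r - 1 - Suc i"
    have j: "1 \<le> j" "j + 1 < r" "r - 1 - i = j + 1" using Suc.prems r2 by (auto simp: j_def)
    have "anc j (f l) = anc j (f (j + 1))" if "l \<le> j + 1" for l
    proof (cases "l = j + 1")
      case False
      then have l: "l < j + 1" using that by simp
      have "anc (j + 1) (f l) = anc (j + 1) (f (j + 1))"
        using Suc.IH Suc.prems j l by simp
      then show ?thesis
        using not_bad[OF l j(2)] root[of l] fN[OF j(2)] l j by (auto simp: bad_def)
    qed simp
    then show ?case unfolding j_def[symmetric] by metis
  qed
  have "r - 1 - (r - 2) = 1" using r2 by simp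
  then have "anc 1 (f 0) = anc 1 (f 1)" using branch[of "r - 2"] r2 by simp
  then have "bad (f 0) (f 1)" using root[of 0] fN[of 1] r2 by (simp add: bad_def)
  then show False using not_bad[of 0 1] r2 by simp
qed

section \<open>Counting the lost edges\<close>

text \<open>A Turan edge missing from the base graph is a bad pair. Given \<open>v\<close> and the
  level of \<open>w\<close>, the parent of \<open>w\<close> is an ancestor of \<open>v\<close>, so
  only the choice among \<open>k\<close> children is free. Hence \<open>code\<close> is injective on
  bad pairs and takes at most \<open>r * r * M * k\<close> values.\<close>

lemma card_base_edges: "turan_number r N \<le> card base_edges + r * r * (t * k ^ r)"
proof -
  define P where "P = {(v, w). v < N \<and> w < N \<and> v mod r < w mod r \<and> bad v w}"
  let ?B = "(\<lambda>(v, w). {v, w}) ` P"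
  define code where "code = (\<lambda>(v, w). (v mod r, w mod r, v div r, w div r mod k))"
  have finP: "finite P" by (rule finite_subset[of _ "{..<N} \<times> {..<N}"]) (auto simp: P_def)
  have finE: "finite base_edges"
    using finite_imp_finite_nsets[of "{..<N + t}" 2] finite_subset[OF base_edges_subset] by simp
  have "turan_edges r N \<subseteq> base_edges \<union> ?B"
  proof
    fix e assume "e \<in> turan_edges r N"
    then obtain u w where "e = {u, w}" "u < N" "w < N" "u mod r \<noteq> w mod r"
      by (auto simp: turan_edges_def partite_edges_def)
    then obtain v w where e: "e = {v, w}" "v < N" "w < N" "v mod r < w mod r"
      by (metis insert_commute linorder_neqE_nat)
    show "e \<in> base_edges \<union> ?B"
    proof (cases "bad v w")
      case True
      then have "(v, w) \<in> P" using e by (simp add: P_def)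
      then show ?thesis using e by force
    next
      case False
      then show ?thesis using e by (auto simp: base_edges_def part_edges_def)
    qed
  qed
  then have "turan_number r N \<le> card (base_edges \<union> ?B)"
    unfolding turan_number_def using finE finP by (intro card_mono) auto
  also have "\<dots> \<le> card base_edges + card P"
    using card_Un_le[of base_edges ?B] card_image_le[OF finP, of "\<lambda>(v, w). {v, w}"] by linarith
  finally have le: "turan_number r N \<le> card base_edges + card P" .
  have "inj_on code P"
  proof (rule inj_onI)
    fix x y assume x: "x \<in> P" and y: "y \<in> P" and eq: "code x = code y"
    obtain v w v' w' where xy: "x = (v, w)" "y = (v', w')" by fastforce
    have c: "v mod r = v' mod r" "w mod r = w' mod r" "v div r = v' div r"
      "w div r mod k = w' div r mod k" using eq by (auto simp: code_def xy)
    have v: "v = v'" using c by (metis div_mult_mod_eq)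
    have q: "anc (w mod r) u = u div r div k" if "u mod r = w mod r" for u
    proof -
      have "w mod r - (w mod r - 1) = 1" using x by (auto simp: P_def xy)
      then show ?thesis using that by (simp add: anc_def)
    qed
    have "anc (w mod r) w = anc (w mod r) w'" using x y v c by (auto simp: P_def xy bad_def)
    then have "w div r div k = w' div r div k" using q[of w] q[of w'] c by simp
    then have "w div r = w' div r" using c by (metis div_mult_mod_eq)
    then have "w = w'" using c by (metis div_mult_mod_eq)
    then show "x = y" using v xy by simp
  qed
  moreover have "code ` P \<subseteq> {..<r} \<times> {..<r} \<times> {..<M} \<times> {..<k}"
    using mod_less k0 bad_index_less by (auto simp: code_def P_def)
  ultimately have "card P \<le> card ({..<r} \<times> {..<r} \<times> {..<M} \<times> {..<k})"
    by (intro card_inj_on_le) auto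
  also have "\<dots> = r * r * (t * (k * k ^ (r - 1)))" by simp
  also have "k * k ^ (r - 1) = k ^ r" using r2 by (cases r) auto
  finally show ?thesis using le by linarith
qed

section \<open>Forced nonadjacencies in clique-free supergraphs\<close>

text \<open>A branch from a root to \<open>x\<close> and \<open>y\<close> is a clique except for the pair \<open>{x, y}\<close>.\<close>

lemma leaves_nonadjacent:
  assumes E: "base_edges \<subseteq> E" "E \<subseteq> [{..<N + t}]\<^bsup>2\<^esup>" "\<not> contains_complete (r + 1) {..<N + t} E"
    and ab: "a < M" "b < M" "a div k = b div k"
  shows "{a * r, b * r + 1} \<notin> E"
proof
  assume xy: "{a * r, b * r + 1} \<in> E"
  define A where "A j = a div k ^ j" for j
  \<comment> \<open>\<open>g\<close> lists the branch: the two leaves, then the ancestor of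
    \<open>a\<close> at height \<open>l - 1\<close> on each level \<open>l\<close>, and finally the
    root.\<close>
  define g where "g l = (if l = 0 then a * r else if l = 1 then b * r + 1
    else if l < r then A (l - 1) * r + l else N + A (r - 1))" for l
  have lt: "i * r + l < N" if "i < M" "l < r" for i l
  proof -
    have "i * r + l < (i + 1) * r" using that by simp
    also have "\<dots> \<le> M * r" using that by (intro mult_right_mono) auto
    also have "\<dots> \<le> N" using room by (simp add: mult.commute)
    finally show ?thesis .
  qed
  have AM: "A j < M" for j
    using ab(1) by (simp add: A_def le_less_trans[OF div_le_dividend])
  have gN: "g l < N" if "l < r" for l
    using lt[of a 0] lt[of b 1] lt[OF AM[of "l - 1"] that] ab r2 that by (auto simp: g_def)
  have gmod: "g l mod r = l" if "l < r" for l
    using that r2 by (auto simp: g_def level1_vertex)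
  \<comment> \<open>Height 0 is excluded because the leaves \<open>a\<close> and \<open>b\<close>
    share a parent but may have different indices.\<close>
  have anc: "anc j (g l) = A j" if "l < r" "l - 1 \<le> j" "1 \<le> j" for l j
  proof -
    consider "l = 0" | "l = 1" | "2 \<le> l" by linarith
    then show ?thesis
    proof cases
      case 1
      then show ?thesis using r2 by (simp add: anc_def g_def A_def)
    next
      case 2
      have "b div k ^ j = b div k div k ^ (j - 1)" "a div k ^ j = a div k div k ^ (j - 1)"
        using that(3) by (cases j; simp add: div_mult2_eq)+
      then show ?thesis using 2 r2 ab by (simp add: anc_def g_def A_def level1_vertex)
    next
      case 3
      then have "anc j (g l) = A (l - 1) div k ^ (j - (l - 1))"
        using that(1) by (simp add: anc_def g_def)
      also have "\<dots> = A j" using that by (simp add: A_def div_mult2_eq[symmetric] power_add[symmetric])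
      finally show ?thesis .
    qed
  qed
  have top: "A (r - 1) < t"
    using ab(1) k0 by (simp add: A_def div_less_iff_less_mult)
  have "contains_complete (r + 1) {..<N + t} E"
  proof (rule contains_complete_family[where h = g])
    fix i j assume ij: "i < j" "j < r + 1"
    show "{g i, g j} \<in> E"
    proof (cases "j = r")
      case True
      then have "anc (r - 1) (g i) = A (r - 1)" "g j = N + A (r - 1)"
        using anc[of i "r - 1"] ij r2 by (auto simp: g_def)
      then have "{g i, g j} \<in> root_edges"
        unfolding root_edges_def using gN[of i] ij top True by force
      then show ?thesis using E(1) by (auto simp: base_edges_def)
    next
      case False
      then have j: "j < r" using ij by simp
      show ?thesis
      proof (cases "j = 1")
        case True
        then show ?thesis using ij xy by (simp add: g_def)
      next
        case False
        then have "anc (j - 1) (g i) = anc (j - 1) (g j)"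
          using anc[of i "j - 1"] anc[of j "j - 1"] ij j by simp
        then have "\<not> bad (g i) (g j)" using False gmod[OF j] by (simp add: bad_def)
        moreover have "g i < N" "g j < N" "g i mod r < g j mod r"
          using gN[of i] gN[of j] gmod[of i] gmod[of j] ij j by simp_all
        ultimately have "{g i, g j} \<in> part_edges"
          unfolding part_edges_def by blast
        then show ?thesis using E(1) by (auto simp: base_edges_def)
      qed
    qed
  qed (use E r2 in auto)
  then show False using E(3) by blast
qed

text \<open>Both ends of a bad pair have index below \<open>M\<close>.\<close>

lemma free_edge:
  assumes "v < N" "w < N" "v mod r < w mod r" "M \<le> v div r \<or> M \<le> w div r"
  shows "{v, w} \<in> base_edges"
proof -
  have "\<not> bad v w" using assms bad_index_less[of v w] by linarith
  then show ?thesis using assms by (auto simp: base_edges_def part_edges_def)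
qed

text \<open>The vertices with index \<open>M\<close> in the levels \<open>1, \<dots>, r - 1\<close> form a clique in the common
  neighbourhood of level \<open>0\<close>.\<close>

lemma level0_nonadjacent:
  assumes E: "base_edges \<subseteq> E" "E \<subseteq> [{..<N + t}]\<^bsup>2\<^esup>" "\<not> contains_complete (r + 1) {..<N + t} E"
    and ab: "a * r < N" "b * r < N"
  shows "{a * r, b * r} \<notin> E"
proof
  assume xz: "{a * r, b * r} \<in> E"
  \<comment> \<open>The second level 0 vertex takes slot \<open>r\<close>; index \<open>M\<close> is
    the first one outside every tree.\<close>
  define g where "g l = (if l = 0 then a * r else if l = r then b * r else M * r + l)" for l
  have uN: "M * r + l < N" if "l < r" for l
  proof -
    have "M * r + l < (M + 1) * r" using that by simp
    also have "\<dots> \<le> (M + M) * r" using M0 by (intro mult_right_mono) auto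
    also have "\<dots> \<le> N" using room by (simp add: algebra_simps)
    finally show ?thesis .
  qed
  have udiv: "(M * r + l) div r = M" "(M * r + l) mod r = l" if "l < r" for l
    using that by auto
  have "contains_complete (r + 1) {..<N + t} E"
  proof (rule contains_complete_family[where h = g])
    fix i j assume ij: "i < j" "j < r + 1"
    consider "i = 0" "j = r" | "i = 0" "j < r" | "0 < i" "j = r" | "0 < i" "j < r"
      using ij by linarith
    then show "{g i, g j} \<in> E"
    proof cases
      case 1
      then show ?thesis using xz r2 by (simp add: g_def)
    next
      case 2
      then have "{a * r, M * r + j} \<in> base_edges"
        using ab uN[of j] udiv[of j] ij by (intro free_edge) auto
      then show ?thesis using 2 ij E(1) by (auto simp: g_def)
    next
      case 3
      then have "{b * r, M * r + i} \<in> base_edges"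
        using ab uN[of i] udiv[of i] ij by (intro free_edge) auto
      then show ?thesis using 3 ij E(1) r2 by (auto simp: g_def insert_commute)
    next
      case 4
      then have "{M * r + i, M * r + j} \<in> base_edges"
        using uN[of i] uN[of j] udiv[of i] udiv[of j] ij by (intro free_edge) auto
      then show ?thesis using 4 ij E(1) by (auto simp: g_def)
    qed
  qed (use E r2 in auto)
  then show False using E(3) by blast
qed

section \<open>Vertices missed by complete partite subgraphs\<close>

text \<open>If fewer than \<open>M\<close> vertices are missed, \<open>U\<close> contains some level
  0 vertex \<open>c * r\<close> outside the trees. All level 0 vertices of \<open>U\<close> share
  its class, and no level 1 vertex of \<open>U\<close> does. So leaves of both levels in
  \<open>U\<close> are adjacent, and they cannot have the same parent.\<close>

lemma complete_partite_misses:
  assumes E: "base_edges \<subseteq> E" "E \<subseteq> [{..<N + t}]\<^bsup>2\<^esup>" "\<not> contains_complete (r + 1) {..<N + t} E"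
    and U: "U \<subseteq> {..<N + t}" "complete_partite s U (induced_edges E U)"
  shows "M \<le> card ({..<N + t} - U)"
proof (rule ccontr)
  let ?D = "{..<N + t} - U"
  assume small: "\<not> M \<le> card ?D"
  obtain p where p: "induced_edges E U = partite_edges U p"
    using U(2) by (auto simp: complete_partite_def)
  have adj: "{u, w} \<in> E \<longleftrightarrow> p u \<noteq> p w" if "u \<in> U" "w \<in> U" for u w
    using that pair_in_partite_edges[of u w U p] unfolding p[symmetric]
    by (simp add: induced_edges_def)
  have lt: "a * r + l < N" if "a < M + M" "l < r" for a l
  proof -
    have "a * r + l < (a + 1) * r" using that by simp
    also have "\<dots> \<le> (M + M) * r" using that by (intro mult_right_mono) auto
    also have "\<dots> \<le> N" using room by (simp add: algebra_simps)
    finally show ?thesis .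
  qed
  have "\<exists>c. M \<le> c \<and> c < M + M \<and> c * r \<in> U"
  proof (rule ccontr)
    assume none: "\<not> ?thesis"
    have "(\<lambda>c. c * r) ` {M..<M + M} \<subseteq> ?D"
    proof
      fix v assume "v \<in> (\<lambda>c. c * r) ` {M..<M + M}"
      then obtain c where "c \<in> {M..<M + M}" and v: "v = c * r" by (rule imageE)
      then have c: "M \<le> c" "c < M + M" by simp_all
      then show "v \<in> ?D" using none lt[of c 0] r2 v by auto
    qed
    moreover have "inj_on (\<lambda>c. c * r) {M..<M + M}" using r2 by (auto simp: inj_on_def)
    ultimately have "card {M..<M + M} \<le> card ?D" by (intro card_inj_on_le) auto
    then show False using small by simp
  qed
  then obtain c where c: "M \<le> c" "c < M + M" "c * r \<in> U" by blast
  have leaves: "a * r \<notin> U \<or> b * r + 1 \<notin> U" if ab: "a < M" "b < M" "a div k = b div k" for a b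
  proof (rule ccontr)
    assume "\<not> ?thesis"
    then have ab_U: "a * r \<in> U" "b * r + 1 \<in> U" by auto
    have "p (a * r) = p (b * r + 1)"
      using leaves_nonadjacent[OF E ab] adj[OF ab_U] by blast
    moreover have "p (a * r) = p (c * r)"
      using level0_nonadjacent[OF E, of a c] adj[OF ab_U(1) c(3)] lt[of a 0] lt[of c 0] ab c r2
      by auto
    moreover have "{c * r, b * r + 1} \<in> base_edges"
      using lt[of c 0] lt[of b 1] ab c r2 by (intro free_edge) (auto simp: level1_vertex)
    then have "p (c * r) \<noteq> p (b * r + 1)" using E(1) adj[OF c(3) ab_U(2)] by auto
    ultimately show False by simp
  qed
  \<comment> \<open>For each index \<open>a\<close> this picks the level 1 leaf if \<open>U\<close>
    contains a level 0 leaf with the same parent, and the level 0 leaf otherwise. Either way it is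
    outside \<open>U\<close>, and its index \<open>a\<close> can be read off.\<close>
  define miss where "miss a = a * r + (if \<exists>a'<M. a' div k = a div k \<and> a' * r \<in> U then 1 else 0)" for a
  have idx: "miss a div r = a" for a using r2 by (simp add: miss_def level1_vertex)
  have "inj_on miss {..<M}" by (rule inj_onI) (metis idx)
  moreover have "miss a \<in> ?D" if "a < M" for a
    using leaves[OF _ that] lt[of a 0] lt[of a 1] that r2 by (auto simp: miss_def)
  then have "miss ` {..<M} \<subseteq> ?D" by auto
  ultimately have "card {..<M} \<le> card ?D" by (intro card_inj_on_le) auto
  then show False using small by simp
qed

end

section \<open>Choice of parameters\<close>

lemma nat_floor_ge_half:
  fixes x :: real
  assumes "1 \<le> x"
  shows "x / 2 \<le> real (nat \<lfloor>x\<rfloor>)" "1 \<le> nat \<lfloor>x\<rfloor>"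
proof -
  have "1 \<le> \<lfloor>x\<rfloor>" using assms by simp
  then have "real (nat \<lfloor>x\<rfloor>) = real_of_int \<lfloor>x\<rfloor>" by simp
  moreover have "1 \<le> real_of_int \<lfloor>x\<rfloor>" using \<open>1 \<le> \<lfloor>x\<rfloor>\<close> by linarith
  ultimately show "x / 2 \<le> real (nat \<lfloor>x\<rfloor>)" by linarith
  show "1 \<le> nat \<lfloor>x\<rfloor>" using \<open>1 \<le> \<lfloor>x\<rfloor>\<close> by linarith
qed

theorem theorem6:
  fixes r :: nat and \<epsilon> :: real
  assumes "r \<ge> 2" and "\<epsilon> > 0"
  shows "\<exists>n\<^sub>0 b\<^sub>0 c\<^sub>0 :: real. n\<^sub>0 > 0 \<and> b\<^sub>0 > 0 \<and> c\<^sub>0 > 0 \<and>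
    (\<forall>(n :: nat) (m :: real).
       m > 0 \<and> real n \<ge> n\<^sub>0 \<and>
       ((real r - 1) / real r + \<epsilon>) * real n \<le> m \<and>
       m \<le> b\<^sub>0 * real n powr ((real r + 1) / real r) \<longrightarrow>
       (\<exists>(V :: nat set) E. simple_graph V E \<and> card V = n \<and>
          saturated (r + 1) V E \<and>
          real (card E) \<ge> real (turan_number r n) - m \<and>
          \<not> (\<exists>U \<subseteq> V. complete_partite r U (induced_edges E U) \<and>
                real (card U) > (1 - c\<^sub>0 * m * real n powr (- ((real r + 1) / real r))) * real n)))"
proof -
  define \<alpha> where "\<alpha> = (real r - 1) / real r + \<epsilon>"
  \<comment> \<open>With \<open>k\<close> at most \<open>\<delta> * y\<close> and
    \<open>y = n^(1/r)\<close>, the loss \<open>r * r * t * k ^ r\<close> is at most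
    \<open>t * \<epsilon> * n\<close>.\<close>
  define \<delta> where "\<delta> = min 1 (\<epsilon> / (real r * real r))"
  \<comment> \<open>This makes \<open>\<delta> * y\<close> at least 1, so that \<open>k\<close> is
    positive.\<close>
  define n0 where "n0 = (1 / \<delta>) ^ r"
  \<comment> \<open>This yields \<open>q \<le> y / (2 * r + 1)\<close>, hence
    \<open>(2 * r + 1) * M \<le> n\<close>: room for \<open>2 * r * M\<close> vertices besides the
    \<open>t \<le> M\<close> roots.\<close>
  define b0 where "b0 = \<alpha> / (2 * real r + 1)"
  \<comment> \<open>The factors 1/2 pay for rounding down \<open>q\<close> and
    \<open>\<delta> * y\<close> to \<open>t\<close> and \<open>k\<close>.\<close>
  define c0 where "c0 = (\<delta> / 2) ^ (r - 1) / (2 * \<alpha>)"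
  have \<alpha>: "0 < \<alpha>" using assms by (simp add: \<alpha>_def add_nonneg_pos)
  have \<delta>: "0 < \<delta>" "\<delta> \<le> 1" "real r * real r * \<delta> \<le> \<epsilon>"
    using assms by (auto simp: \<delta>_def min_def field_simps)
  have \<delta>r: "real r * real r * \<delta> ^ r \<le> \<epsilon>"
  proof -
    have "\<delta> ^ r \<le> \<delta> ^ 1" using \<delta> assms by (intro power_decreasing) auto
    then have "real r * real r * \<delta> ^ r \<le> real r * real r * \<delta>" by (intro mult_left_mono) auto
    then show ?thesis using \<delta> by simp
  qed
  have pos: "0 < n0" "0 < b0" "0 < c0" using \<alpha> \<delta> by (simp_all add: n0_def b0_def c0_def)
  have "\<exists>(V :: nat set) E. simple_graph V E \<and> card V = n \<and> saturated (r + 1) V E \<and>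
      real (card E) \<ge> real (turan_number r n) - m \<and>
      \<not> (\<exists>U \<subseteq> V. complete_partite r U (induced_edges E U) \<and>
            real (card U) > (1 - c0 * m * real n powr (- ((real r + 1) / real r))) * real n)"
    if m: "m > 0" and n: "real n \<ge> n0" and lo: "\<alpha> * real n \<le> m"
      and hi: "m \<le> b0 * real n powr ((real r + 1) / real r)" for n :: nat and m :: real
  proof -
    define y where "y = real n powr (1 / real r)"
    have n_pos: "0 < real n" using n pos by linarith
    have y: "0 < y" using n_pos by (simp add: y_def)
    have y_pow: "y ^ r = real n"
      using n_pos assms by (simp add: y_def powr_powr flip: powr_realpow)
    have y_pow1: "y * y ^ (r - 1) = real n" using y_pow assms by (cases r) auto
    have exp: "(real r + 1) / real r = 1 + 1 / real r" using assms by (simp add: field_simps)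
    have up: "real n powr ((real r + 1) / real r) = real n * y"
      unfolding exp using n_pos by (simp add: y_def powr_add)
    have down: "real n powr (- ((real r + 1) / real r)) = 1 / (real n * y)"
      unfolding powr_minus up by (simp add: inverse_eq_divide)
    have dy: "1 \<le> \<delta> * y"
    proof -
      have "(1 / \<delta>) ^ r \<le> y ^ r" using n y_pow by (simp add: n0_def)
      then have "1 / \<delta> \<le> y" using power_le_imp_le_base[of "1 / \<delta>" "r - 1" y] y assms by simp
      then show ?thesis using \<delta> by (simp add: field_simps)
    qed
    define k where "k = nat \<lfloor>\<delta> * y\<rfloor>"
    \<comment> \<open>Each extra vertex costs at most \<open>\<alpha> * n\<close> edges:
      \<open>(r - 1) / r * n\<close> in the Turan number and \<open>\<epsilon> * n\<close> in bad
      pairs. So \<open>m\<close> pays for \<open>q\<close> of them.\<close>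
    define q where "q = m / (\<alpha> * real n)"
    define t where "t = nat \<lfloor>q\<rfloor>"
    have q: "1 \<le> q" using lo \<alpha> n_pos by (simp add: q_def)
    have k: "1 \<le> k" "\<delta> * y / 2 \<le> real k" "real k \<le> \<delta> * y"
      unfolding k_def using nat_floor_ge_half[OF dy] dy by auto
    have t: "1 \<le> t" "q / 2 \<le> real t" "real t \<le> q"
      unfolding t_def using nat_floor_ge_half[OF q] q by auto
    have q_hi: "q \<le> y / (2 * real r + 1)"
    proof -
      have "m \<le> \<alpha> / (2 * real r + 1) * (real n * y)" using hi by (simp add: up b0_def)
      then have "q \<le> (\<alpha> / (2 * real r + 1) * (real n * y)) / (\<alpha> * real n)"
        unfolding q_def using \<alpha> n_pos by (intro divide_right_mono) auto
      also have "\<dots> = y / (2 * real r + 1)" using \<alpha> n_pos by simp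
      finally show ?thesis .
    qed
    define M where "M = t * k ^ (r - 1)"
    have room: "(2 * r + 1) * M \<le> n"
    proof -
      have "real k ^ (r - 1) \<le> y ^ (r - 1)"
        using k(3) \<delta> y by (intro power_mono) (auto intro: order_trans[OF _ mult_left_le_one_le])
      then have "real M \<le> y / (2 * real r + 1) * y ^ (r - 1)"
        unfolding M_def of_nat_mult of_nat_power using t q_hi y by (intro mult_mono) auto
      also have "\<dots> = real n / (2 * real r + 1)" using y_pow1 by simp
      finally have "(2 * real r + 1) * real M \<le> real n" by (simp add: field_simps)
      then have "real ((2 * r + 1) * M) \<le> real n" by (simp add: algebra_simps)
      then show ?thesis by (simp only: of_nat_le_iff)
    qed
    define N where "N = n - t"
    have "t \<le> M" using k by (simp add: M_def)
    then have tn: "N + t = n" "2 * r * M \<le> N" using room by (simp_all add: N_def)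
    interpret layered r k t N
    proof
      show "2 * r * (t * k ^ (r - 1)) \<le> N" using tn(2) by (simp only: M_def)
    qed (use assms k t in simp_all)
    obtain E where E: "base_edges \<subseteq> E" "E \<subseteq> [{..<N + t}]\<^bsup>2\<^esup>" "saturated (r + 1) {..<N + t} E"
      using saturated_extension[OF _ base_edges_subset base_no_complete] by blast
    then have free: "\<not> contains_complete (r + 1) {..<N + t} E" by (simp add: saturated_def)
    have finE: "finite E"
      using finite_imp_finite_nsets[of "{..<N + t}" 2] finite_subset[OF E(2)] by simp
    have edges: "real (turan_number r n) - m \<le> real (card E)"
    proof -
      have "real (turan_number r n) \<le>
          real (turan_number r N) + real t * ((real r - 1) / real r * real n)"
        using turan_number_add[of r N t] assms tn by simp
      moreover have "real (turan_number r N) \<le> real (card E) + real r * real r * (real t * real k ^ r)"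
      proof -
        have "turan_number r N \<le> card E + r * r * (t * k ^ r)"
          using card_base_edges card_mono[OF finE E(1)] by linarith
        then have "real (turan_number r N) \<le> real (card E + r * r * (t * k ^ r))"
          by (simp only: of_nat_le_iff)
        then show ?thesis by simp
      qed
      moreover have "real r * real r * (real t * real k ^ r) \<le> real t * (\<epsilon> * real n)"
      proof -
        have "real k ^ r \<le> \<delta> ^ r * real n"
          using power_mono[OF k(3), of r] y_pow by (simp add: power_mult_distrib)
        then have "real r * real r * real k ^ r \<le> real r * real r * (\<delta> ^ r * real n)"
          by (intro mult_left_mono) auto
        also have "\<dots> \<le> \<epsilon> * real n"
          using mult_right_mono[OF \<delta>r, of "real n"] by (simp add: mult.assoc)
        finally have "real t * (real r * real r * real k ^ r) \<le> real t * (\<epsilon> * real n)"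
          by (intro mult_left_mono) auto
        then show ?thesis by (simp add: mult_ac)
      qed
      moreover have "real t * ((real r - 1) / real r * real n) + real t * (\<epsilon> * real n) \<le> m"
      proof -
        have "real t * (\<alpha> * real n) \<le> q * (\<alpha> * real n)" using t \<alpha> by (intro mult_right_mono) auto
        also have "\<dots> = m" using \<alpha> n_pos by (simp add: q_def)
        finally show ?thesis by (simp add: \<alpha>_def distrib_left distrib_right)
      qed
      ultimately show ?thesis by linarith
    qed
    have large: "c0 * m * real n powr (- ((real r + 1) / real r)) * real n \<le> real M"
    proof -
      have "c0 * m * real n powr (- ((real r + 1) / real r)) * real n = c0 * m / y"
        unfolding down using n_pos by simp
      also have "\<dots> = q / 2 * (\<delta> / 2) ^ (r - 1) * (real n / y)"
        unfolding c0_def q_def using \<alpha> n_pos y by (simp add: field_simps)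
      also have "real n / y = y ^ (r - 1)" using y y_pow1 by (simp add: field_simps)
      also have "q / 2 * (\<delta> / 2) ^ (r - 1) * y ^ (r - 1) = q / 2 * (\<delta> * y / 2) ^ (r - 1)"
        by (simp add: power_divide power_mult_distrib)
      also have "\<dots> \<le> real t * real k ^ (r - 1)"
        using t k \<delta> y q by (intro mult_mono power_mono) auto
      finally show ?thesis by (simp add: M_def)
    qed
    have "\<not> real (card U) > (1 - c0 * m * real n powr (- ((real r + 1) / real r))) * real n"
      if U: "U \<subseteq> {..<n}" "complete_partite r U (induced_edges E U)" for U
    proof -
      have "M \<le> card ({..<n} - U)"
        using complete_partite_misses[OF E(1,2) free, of U r] U by (simp add: tn M_def)
      also have "\<dots> = n - card U" using U by (simp add: card_Diff_subset finite_subset)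
      finally have "M \<le> n - card U" .
      moreover have "card U \<le> n" using card_mono[OF _ U(1)] by simp
      ultimately have "real M + real (card U) \<le> real n" by linarith
      then show ?thesis using large by (simp add: left_diff_distrib)
    qed
    then show ?thesis
      using E edges unfolding tn simple_graph_def
      by (intro exI[of _ "{..<n}"] exI[of _ E]) auto
  qed
  then show ?thesis using pos unfolding \<alpha>_def by blast
qed

end
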